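(* For all integers $n,k\geq 0$, \begin{align*} c_{9,5}\left(2^{3k+5}n+\frac{27\cdot 2^{3k+3}+1}{7}\right)&\equiv 0\pmod 2,\\ c_{9,5}\left(2^{3k+6}n+\frac{3\cdot 2^{3k+4}+1}{7}\right)&\equiv 0\pmod 2,\\ c_{9,5}\left(2^{3k+7}n+\frac{19\cdot 2^{3k+5}+1}{7}\right)&\equiv 0\pmod 2. \end{align*}
   Context: For complex $a,b$ the false theta function is $\Psi(a,b):=\sum_{n=0}^\infty a^{n(n+1)/2}b^{n(n-1)/2}-\sum_{n=-\infty}^{-1}a^{n(n+1)/2}b^{n(n-1)/2}$. For positive integers $r,s$, the integers $c_{r,s}(n)$ ($n\ge 0$) are defined by the power series identity $\sum_{n=0}^\infty c_{r,s}(n)q^n=\dfrac{1}{\Psi(-q^r,q^s)}$ (the denominator is a power series in $q$ with constant term $1$). *)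

theory Defs
  imports
    "HOL-Analysis.Infinite_Sum"
    "HOL-Computational_Algebra.Formal_Power_Series"
    "HOL-Number_Theory.Cong"
    Complex_Main
begin

text \<open>
  The false theta function is defined over an arbitrary commutative topological ring. Over the
  complex numbers this is the usual function \<open>\<Psi>(a, b)\<close>; over \<open>complex fps\<close>, where convergence
  means that each coefficient is eventually constant, it makes the formal substitution
  \<open>a = - q\<^sup>r\<close>, \<open>b = q\<^sup>s\<close> meaningful. Both \<open>n(n+1)/2\<close> and \<open>n(n-1)/2\<close> are nonnegative integers for
  every integer \<open>n\<close>, so neither \<open>div\<close> nor \<open>nat\<close> loses information.
\<close>

definition false_theta_term :: "'a::comm_ring_1 \<Rightarrow> 'a \<Rightarrow> int \<Rightarrow> 'a" where
  "false_theta_term a b n = a ^ nat (n * (n + 1) div 2) * b ^ nat (n * (n - 1) div 2)"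

definition false_theta :: "'a::{comm_ring_1, t2_space} \<Rightarrow> 'a \<Rightarrow> 'a" where
  "false_theta a b =
     (\<Sum>\<^sub>\<infinity>n\<in>{0..}. false_theta_term a b n) - (\<Sum>\<^sub>\<infinity>n\<in>{..-1}. false_theta_term a b n)"

text \<open>
  The integers \<open>c\<^bsub>r,s\<^esub>(n)\<close>. For positive \<open>r\<close> and \<open>s\<close>, existence and uniqueness are shown in
  \<open>c_coeff_ex1\<close> below.
\<close>

definition c_coeff :: "nat \<Rightarrow> nat \<Rightarrow> nat \<Rightarrow> int" where
  "c_coeff r s = (THE c. Abs_fps (\<lambda>n. of_int (c n)) =
     1 / (false_theta (- (fps_X ^ r)) (fps_X ^ s) :: complex fps))"

lemma triangular_exponents:
  fixes n :: int
  shows "n * (n + 1) div 2 \<ge> 0" "n * (n - 1) div 2 \<ge> 0"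
    and "nat (n * (n + 1) div 2) + nat (n * (n - 1) div 2) = nat \<bar>n\<bar> ^ 2"
proof -
  have nonneg: "n * (n + 1) \<ge> 0" "n * (n - 1) \<ge> 0"
    by (cases "n \<ge> 0"; cases "n = 0"; simp add: zero_le_mult_iff)+
  then show A: "n * (n + 1) div 2 \<ge> 0" and B: "n * (n - 1) div 2 \<ge> 0"
    by simp_all
  have "2 * (n * (n + 1) div 2) = n * (n + 1)" "2 * (n * (n - 1) div 2) = n * (n - 1)"
    by simp_all
  moreover have "n * (n + 1) + n * (n - 1) = 2 * n ^ 2"
    by (simp add: power2_eq_square algebra_simps)
  ultimately have "n * (n + 1) div 2 + n * (n - 1) div 2 = n ^ 2"
    by linarith
  then have "int (nat (n * (n + 1) div 2) + nat (n * (n - 1) div 2)) = int (nat \<bar>n\<bar> ^ 2)"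
    using A B by simp
  then show "nat (n * (n + 1) div 2) + nat (n * (n - 1) div 2) = nat \<bar>n\<bar> ^ 2"
    by (simp only: of_nat_eq_iff)
qed

lemma false_theta_term_fps_nth:
  "fps_nth (false_theta_term (- (fps_X ^ r)) (fps_X ^ s) n :: 'a::comm_ring_1 fps) k =
     (if k = r * nat (n * (n + 1) div 2) + s * nat (n * (n - 1) div 2)
      then (- 1) ^ nat (n * (n + 1) div 2) else 0)"
proof -
  define A B where "A = nat (n * (n + 1) div 2)" and "B = nat (n * (n - 1) div 2)"
  have "false_theta_term (- (fps_X ^ r)) (fps_X ^ s) n =
          (- 1) ^ A * (fps_X ^ (r * A + s * B) :: 'a fps)"
    unfolding false_theta_term_def A_def[symmetric] B_def[symmetric]
    by (subst power_minus) (simp add: power_mult power_add)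
  also have "\<dots> = fps_const ((- 1) ^ A) * fps_X ^ (r * A + s * B)"
    by (simp flip: fps_const_power fps_const_neg)
  finally show ?thesis
    unfolding A_def[symmetric] B_def[symmetric] by (simp add: fps_X_power_nth)
qed

lemma false_theta_term_fps_nth_nonzeroD:
  assumes "r > 0" "s > 0"
    and "fps_nth (false_theta_term (- (fps_X ^ r)) (fps_X ^ s) n :: 'a::comm_ring_1 fps) k \<noteq> 0"
  shows "nat \<bar>n\<bar> ^ 2 \<le> k"
proof -
  have "k = r * nat (n * (n + 1) div 2) + s * nat (n * (n - 1) div 2)"
    using assms(3) by (simp add: false_theta_term_fps_nth split: if_splits)
  moreover have "nat (n * (n + 1) div 2) \<le> r * nat (n * (n + 1) div 2)"
    and "nat (n * (n - 1) div 2) \<le> s * nat (n * (n - 1) div 2)"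
    using assms(1,2) by simp_all
  ultimately show ?thesis
    using triangular_exponents(3)[of n] by linarith
qed

lemma finite_false_theta_support:
  assumes "r > 0" "s > 0"
  shows "finite {n \<in> A. fps_nth (false_theta_term (- (fps_X ^ r)) (fps_X ^ s) n
           :: 'a::comm_ring_1 fps) k \<noteq> 0}"
proof (rule finite_subset)
  show "{n \<in> A. fps_nth (false_theta_term (- (fps_X ^ r)) (fps_X ^ s) n :: 'a fps) k \<noteq> 0}
          \<subseteq> {- int k..int k}"
  proof
    fix n
    assume "n \<in> {n \<in> A. fps_nth (false_theta_term (- (fps_X ^ r)) (fps_X ^ s) n :: 'a fps) k \<noteq> 0}"
    then have "nat \<bar>n\<bar> ^ 2 \<le> k"
      using false_theta_term_fps_nth_nonzeroD[OF assms] by blast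
    moreover have "nat \<bar>n\<bar> \<le> nat \<bar>n\<bar> ^ 2"
      unfolding power2_eq_square by (rule le_square)
    ultimately have "nat \<bar>n\<bar> \<le> k" by linarith
    then show "n \<in> {- int k..int k}" by auto
  qed
qed simp

lemma has_sum_false_theta_term:
  assumes "r > 0" "s > 0"
  shows "(false_theta_term (- (fps_X ^ r)) (fps_X ^ s) has_sum
           Abs_fps (\<lambda>k. \<Sum>n | n \<in> A \<and>
             fps_nth (false_theta_term (- (fps_X ^ r)) (fps_X ^ s) n :: 'a::comm_ring_1 fps) k \<noteq> 0.
             fps_nth (false_theta_term (- (fps_X ^ r)) (fps_X ^ s) n :: 'a fps) k)) A"
  by (rule has_sum_fpsI) (use finite_false_theta_support[OF assms] in simp_all)

lemma false_theta_fps_nth: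
  assumes "r > 0" "s > 0"
  shows "fps_nth (false_theta (- (fps_X ^ r)) (fps_X ^ s) :: 'a::comm_ring_1 fps) k =
     (\<Sum>n | n \<in> {0..} \<and> fps_nth (false_theta_term (- (fps_X ^ r)) (fps_X ^ s) n :: 'a fps) k \<noteq> 0.
        fps_nth (false_theta_term (- (fps_X ^ r)) (fps_X ^ s) n) k) -
     (\<Sum>n | n \<in> {..-1} \<and> fps_nth (false_theta_term (- (fps_X ^ r)) (fps_X ^ s) n :: 'a fps) k \<noteq> 0.
        fps_nth (false_theta_term (- (fps_X ^ r)) (fps_X ^ s) n) k)"
  unfolding false_theta_def
  using infsumI[OF has_sum_false_theta_term[OF assms, of "{0..}", where 'a = 'a]]
    infsumI[OF has_sum_false_theta_term[OF assms, of "{..-1}", where 'a = 'a]]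
  by simp

lemma false_theta_fps_nth_0:
  assumes "r > 0" "s > 0"
  shows "fps_nth (false_theta (- (fps_X ^ r)) (fps_X ^ s) :: 'a::comm_ring_1 fps) 0 = 1"
proof -
  let ?t = "\<lambda>n. fps_nth (false_theta_term (- (fps_X ^ r)) (fps_X ^ s) n :: 'a fps) 0"
  have iff: "?t n \<noteq> 0 \<longleftrightarrow> n = 0" for n
  proof
    assume "?t n \<noteq> 0"
    from false_theta_term_fps_nth_nonzeroD[OF assms this] show "n = 0" by simp
  qed (simp add: false_theta_term_def)
  have "{n. n \<in> {0..} \<and> ?t n \<noteq> 0} = {0}" "{n. n \<in> {..-1} \<and> ?t n \<noteq> 0} = {}"
    unfolding iff by auto
  then show ?thesis
    unfolding false_theta_fps_nth[OF assms] by (simp add: false_theta_term_def)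
qed

lemma false_theta_fps_of_int:
  assumes "r > 0" "s > 0"
  shows "fps_nth (false_theta (- (fps_X ^ r)) (fps_X ^ s) :: complex fps) k =
     of_int (fps_nth (false_theta (- (fps_X ^ r)) (fps_X ^ s)) k)"
proof -
  have "fps_nth (false_theta_term (- (fps_X ^ r)) (fps_X ^ s) n :: complex fps) k =
          of_int (fps_nth (false_theta_term (- (fps_X ^ r)) (fps_X ^ s) n) k)" for n
    unfolding false_theta_term_fps_nth by simp
  then show ?thesis
    unfolding false_theta_fps_nth[OF assms] by simp
qed

lemma c_coeff_ex1:
  assumes "r > 0" "s > 0"
  shows "\<exists>!c :: nat \<Rightarrow> int. Abs_fps (\<lambda>n. of_int (c n)) =
     1 / (false_theta (- (fps_X ^ r)) (fps_X ^ s) :: complex fps)"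
proof -
  let ?P = "false_theta (- (fps_X ^ r)) (fps_X ^ s) :: complex fps"
  let ?Q = "false_theta (- (fps_X ^ r)) (fps_X ^ s) :: int fps"
  define g where "g = fps_right_inverse ?Q 1"
  define G :: "complex fps" where "G = Abs_fps (\<lambda>n. of_int (fps_nth g n))"
  have Qg: "?Q * g = 1"
    unfolding g_def by (rule fps_right_inverse) (simp add: false_theta_fps_nth_0[OF assms])
  have "?P * G = 1"
  proof (rule fps_ext)
    fix n
    have "fps_nth (?P * G) n = of_int (fps_nth (?Q * g) n)"
      by (simp add: fps_mult_nth G_def false_theta_fps_of_int[OF assms])
    then show "fps_nth (?P * G) n = fps_nth 1 n"
      by (simp add: Qg)
  qed
  then have "inverse ?P = G"
    by (rule fps_inverse_unique)
  moreover have "1 / ?P = inverse ?P"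
    by (subst fps_divide_unit) (simp_all add: false_theta_fps_nth_0[OF assms])
  ultimately have G: "1 / ?P = G" by simp
  show ?thesis
  proof (rule ex1I)
    show "Abs_fps (\<lambda>n. of_int (fps_nth g n)) = 1 / ?P"
      by (simp add: G G_def)
  next
    fix c :: "nat \<Rightarrow> int"
    assume "Abs_fps (\<lambda>n. of_int (c n)) = 1 / ?P"
    then show "c = fps_nth g"
      unfolding G G_def by (auto simp: fps_eq_iff)
  qed
qed

lemma c_coeff_generating_function:
  assumes "r > 0" "s > 0"
  shows "Abs_fps (\<lambda>n. of_int (c_coeff r s n)) =
     1 / (false_theta (- (fps_X ^ r)) (fps_X ^ s) :: complex fps)"
  unfolding c_coeff_def by (rule theI'[OF c_coeff_ex1[OF assms]])

end

theory Submission
  imports Defs "HOL-Library.Z2" "HOL-Computational_Algebra.Formal_Laurent_Series"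
begin

text \<open>
  Modulo 2, \<open>\<Psi>(-q\<^sup>9, q\<^sup>5)\<close> is the sum of all \<open>q\<^bsup>7n\<^sup>2 + 2n\<^esup>\<close>, and
  \<open>7(7n\<^sup>2 + 2n) + 1 = (7n + 1)\<^sup>2\<close>. Write \<open>x\<close>, \<open>y\<close>, \<open>z\<close> for the series over the field with two
  elements summing \<open>q\<^bsup>u\<^sup>2\<^esup>\<close> over \<open>u \<equiv> 1, 2, 3\<close> modulo 7. Then \<open>c\<^bsub>9,5\<^esub>(N)\<close> modulo 2 is the
  coefficient of \<open>q\<^bsup>7N - 1\<^esup>\<close> in \<open>1/x\<close>. Let \<open>U\<close> keep the even exponents and halve them; then
  \<open>U(f\<^sup>2 g) = f U(g)\<close> in characteristic 2. Moreover \<open>U(x) = z\<^sup>2\<close>, and the substitution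
  \<open>u = d - c\<close>, \<open>v = d + c\<close> with \<open>u\<^sup>2 + v\<^sup>2 = 2(c\<^sup>2 + d\<^sup>2)\<close> gives \<open>U(xz) = xy\<close>. Hence
  \<open>U(1/x) = z\<^sup>2/x\<close>, \<open>U\<^sup>2(1/x) = z\<^sup>3/x\<close> and \<open>U\<^sup>3(1/x) = yz\<close>, so that the coefficient of \<open>q\<^bsup>8m\<^esup>\<close>
  in \<open>1/x\<close> vanishes unless \<open>m\<close> is a sum of two squares. In the three progressions,
  \<open>(7N - 1)/8\<close> is a power of 2 times a number congruent to 3 modulo 4.
\<close>

section \<open>Squaring and the halving operator U over the field with two elements\<close>

text \<open>These rules turn sums and products of bits into XOR and AND, out of reach of ring rewriting.\<close>

declare add_bit_eq_xor [simp del] mult_bit_eq_and [simp del]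

lemma bit_double [simp]: "(b::bit) + b = 0"
  by (cases b) (simp_all flip: mult_2)

lemma bit_mult_self [simp]: "(b::bit) * b = b"
  by (cases b) simp_all

lemma of_int_bit_eq_0_iff: "of_int i = (0::bit) \<longleftrightarrow> even i"
  by (cases "even i") (auto elim!: evenE oddE)

text \<open>The swap of i and n - i pairs equal off-diagonal terms, which cancel in characteristic
  2. Only a middle term i = n/2 can survive.\<close>

lemma fps_bit_square_nth:
  fixes f :: "bit fps"
  shows "fps_nth (f ^ 2) n = (if even n then fps_nth f (n div 2) else 0)"
proof -
  let ?t = "\<lambda>i. fps_nth f i * fps_nth f (n - i)"
  let ?L = "{i. 2 * i < n}" and ?M = "{i. 2 * i = n}" and ?R = "{i. i \<le> n \<and> n < 2 * i}"
  have fin: "finite ?L" "finite ?R" "finite ?M"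
    by (rule finite_subset[of _ "{0..n}"]; auto)+
  have "fps_nth (f ^ 2) n = sum ?t (?M \<union> (?L \<union> ?R))"
    unfolding power2_eq_square fps_mult_nth by (rule sum.cong) auto
  also have "\<dots> = sum ?t ?M + (sum ?t ?L + sum ?t ?R)"
    using fin by (subst sum.union_disjoint; (subst sum.union_disjoint)?) auto
  also have "sum ?t ?R = sum ?t ?L"
    by (rule sum.reindex_bij_witness[of _ "\<lambda>i. n - i" "\<lambda>i. n - i"]) (auto simp: mult.commute)
  also have "sum ?t ?M = (if even n then fps_nth f (n div 2) else 0)"
  proof (cases "even n")
    case True
    then have "?M = {n div 2}" by auto
    moreover have "n - n div 2 = n div 2" using True by auto
    ultimately show ?thesis using True by simp
  next
    case False
    then have "?M = {}" by auto
    then show ?thesis using False by (simp only: sum.empty if_False)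
  qed
  finally show ?thesis by simp
qed

text \<open>This is the operator U.\<close>

definition even_part :: "'a fps \<Rightarrow> 'a fps" where
  "even_part f = Abs_fps (\<lambda>n. fps_nth f (2 * n))"

lemma even_part_nth [simp]: "fps_nth (even_part f) n = fps_nth f (2 * n)"
  by (simp add: even_part_def)

text \<open>By \<open>fps_bit_square_nth\<close> the square of f lives on even exponents, so it
  meets only the even exponents of g; halving then turns it back into f.\<close>

lemma even_part_square_mult:
  fixes f g :: "bit fps"
  shows "even_part (f ^ 2 * g) = f * even_part g"
proof (rule fps_ext)
  fix n
  have "fps_nth (even_part (f ^ 2 * g)) n =
      (\<Sum>i = 0..2 * n. (if even i then fps_nth f (i div 2) else 0) * fps_nth g (2 * n - i))"
    by (simp add: fps_mult_nth fps_bit_square_nth)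
  also have "\<dots> = (\<Sum>i\<in>(\<lambda>j. 2 * j) ` {0..n}.
      (if even i then fps_nth f (i div 2) else 0) * fps_nth g (2 * n - i))"
    by (rule sum.mono_neutral_right) (auto elim!: evenE)
  also have "\<dots> = (\<Sum>j = 0..n. fps_nth f j * fps_nth g (2 * (n - j)))"
    by (subst sum.reindex) (auto simp: inj_on_def diff_mult_distrib2)
  finally show "fps_nth (even_part (f ^ 2 * g)) n = fps_nth (f * even_part g) n"
    by (simp add: fps_mult_nth)
qed

section \<open>Theta series of residue classes modulo 7\<close>

text \<open>Over \<open>bit\<close>, the arguments 1, 2, 3 give x, y, z. With coefficients that
  count roots, a product counts pairs, and identities reduce to bijections.\<close>

definition theta7 :: "int \<Rightarrow> 'a::semiring_1 fps" where
  "theta7 a = Abs_fps (\<lambda>n. of_nat (card {u::int. u mod 7 = a \<and> u\<^sup>2 = int n}))"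

lemma finite_square_eq: "finite {u::int. P u \<and> u\<^sup>2 = int n}"
proof (rule finite_subset)
  show "{u::int. P u \<and> u\<^sup>2 = int n} \<subseteq> {- int n..int n}"
  proof clarsimp
    fix u :: int
    assume "u\<^sup>2 = int n"
    moreover have "\<bar>u\<bar> * 1 \<le> \<bar>u\<bar> * \<bar>u\<bar>"
      by (cases "u = 0") (simp, intro mult_left_mono, simp_all)
    ultimately have "\<bar>u\<bar> \<le> int n" by (simp add: power2_eq_square)
    then show "- int n \<le> u \<and> u \<le> int n" by linarith
  qed
qed simp

lemma theta7_mult_nth:
  "fps_nth (theta7 a * theta7 b :: 'a::semiring_1 fps) n =
     of_nat (card {(u::int, v::int). u mod 7 = a \<and> v mod 7 = b \<and> u\<^sup>2 + v\<^sup>2 = int n})"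
proof -
  let ?A = "\<lambda>a i. {u::int. u mod 7 = a \<and> u\<^sup>2 = int i}"
  have "{(u, v). u mod 7 = a \<and> v mod 7 = b \<and> u\<^sup>2 + v\<^sup>2 = int n} =
      (\<Union>i\<in>{0..n}. ?A a i \<times> ?A b (n - i))"
  proof (safe, goal_cases)
    case (1 u v)
    have "u\<^sup>2 \<ge> 0" "v\<^sup>2 \<ge> 0" by simp_all
    with 1 have "nat (u\<^sup>2) \<le> n" "v\<^sup>2 = int (n - nat (u\<^sup>2))" by linarith+
    with 1 show ?case
      by (intro UN_I[of "nat (u\<^sup>2)"]) auto
  qed (auto simp: of_nat_diff)
  moreover have "card \<dots> = (\<Sum>i = 0..n. card (?A a i \<times> ?A b (n - i)))"
    by (rule card_UN_disjoint) (simp, intro ballI finite_cartesian_product finite_square_eq, auto)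
  ultimately show ?thesis
    by (simp add: fps_mult_nth theta7_def card_cartesian_product)
qed

text \<open>An even square has an even root, written here as -2w; the sign fits because -2 * 3 is 1
  modulo 7. The exponent of q after halving is then 2w^2, as in the squared series.\<close>

lemma even_part_theta7_1: "even_part (theta7 1) = (theta7 3 :: bit fps) ^ 2"
proof (rule fps_ext)
  fix n
  show "fps_nth (even_part (theta7 1)) n = fps_nth ((theta7 3 :: bit fps) ^ 2) n"
  proof (cases "even n")
    case True
    then obtain m where m: "n = 2 * m" by blast
    have "bij_betw (\<lambda>u. - 2 * u) {u::int. u mod 7 = 3 \<and> u\<^sup>2 = int m}
        {u. u mod 7 = 1 \<and> u\<^sup>2 = int (2 * n)}"
    proof (rule bij_betw_byWitness[where f' = "\<lambda>u. - (u div 2)"], goal_cases)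
      case 2
      show ?case
      proof safe
        fix u :: int
        assume "u\<^sup>2 = int (2 * n)"
        then have "even (u\<^sup>2)" by simp
        then have "even u" by simp
        then show "- 2 * - (u div 2) = u" by simp
      qed
    next
      case 3
      show ?case
      proof clarify
        fix u :: int
        assume u: "u mod 7 = 3" "u\<^sup>2 = int m"
        have "(- 2 * u) mod 7 = 1" using u(1) by presburger
        moreover have "(- 2 * u)\<^sup>2 = int (2 * n)"
          using u(2) by (simp add: m power_mult_distrib)
        ultimately show "(- 2 * u) mod 7 = 1 \<and> (- 2 * u)\<^sup>2 = int (2 * n)" ..
      qed
    next
      case 4
      show ?case
      proof clarify
        fix u :: int
        assume u: "u mod 7 = 1" "u\<^sup>2 = int (2 * n)"
        have "even (u\<^sup>2)" unfolding u(2) by simp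
        then obtain w where w: "u = 2 * w" by auto
        have "- w mod 7 = 3" using u(1) unfolding w by presburger
        moreover have "(- w)\<^sup>2 = int m"
          using u(2) unfolding w m by (simp add: power_mult_distrib)
        ultimately show "- (u div 2) mod 7 = 3 \<and> (- (u div 2))\<^sup>2 = int m"
          unfolding w by simp
      qed
    qed auto
    from bij_betw_same_card[OF this] show ?thesis
      by (simp add: fps_bit_square_nth theta7_def m)
  next
    case False
    have empty: "{u::int. u mod 7 = 1 \<and> u\<^sup>2 = int (2 * n)} = {}"
    proof safe
      fix u :: int
      assume u: "u\<^sup>2 = int (2 * n)"
      then have "even (u\<^sup>2)" by simp
      then obtain w where "u = 2 * w" by auto
      with u have "int n = 2 * w\<^sup>2" by (simp add: power_mult_distrib)
      then have "even n" by presburger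
      with False show "u \<in> {}" by simp
    qed
    have "fps_nth (even_part (theta7 1)) n = (0 :: bit)"
      by (simp only: even_part_nth theta7_def fps_nth_Abs_fps empty card.empty of_nat_0)
    with False show ?thesis by (simp add: fps_bit_square_nth)
  qed
qed

text \<open>An even sum of two squares forces u and v to have equal parity, so the rotation by c =
  (v - u)/2, d = (u + v)/2 is integral. It sends the residues 1, 3 to 1, 2. Being a bijection, it
  works over every semiring.\<close>

lemma even_part_theta7_1_mult_3:
  "even_part (theta7 1 * theta7 3) = (theta7 1 * theta7 2 :: 'a::semiring_1 fps)"
proof (rule fps_ext)
  fix n
  have "bij_betw (\<lambda>(c, d). (d - c, d + c))
      {(c::int, d::int). c mod 7 = 1 \<and> d mod 7 = 2 \<and> c\<^sup>2 + d\<^sup>2 = int n}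
      {(u, v). u mod 7 = 1 \<and> v mod 7 = 3 \<and> u\<^sup>2 + v\<^sup>2 = int (2 * n)}"
  proof (rule bij_betw_byWitness[where f' = "\<lambda>(u, v). ((v - u) div 2, (u + v) div 2)"], goal_cases)
    case 1
    show ?case by auto
  next
    case 2
    show ?case
    proof clarify
      fix u v :: int
      assume "u\<^sup>2 + v\<^sup>2 = int (2 * n)"
      then have "even (u\<^sup>2 + v\<^sup>2)" by simp
      then have "even (u + v)" by simp
      then show "(u + v) div 2 - (v - u) div 2 = u \<and> (u + v) div 2 + (v - u) div 2 = v"
        by presburger
    qed
  next
    case 3
    show ?case
    proof (safe, goal_cases)
      case (1 _ _ c d)
      then show ?case by presburger
    next
      case (2 _ _ c d)
      then show ?case by presburger
    next
      case (3 _ _ c d)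
      then show ?case by (simp add: power2_eq_square algebra_simps)
    qed
  next
    case 4
    show ?case
    proof clarify
      fix u v :: int
      assume uv: "u mod 7 = 1" "v mod 7 = 3" "u\<^sup>2 + v\<^sup>2 = int (2 * n)"
      have "even (u\<^sup>2 + v\<^sup>2)" using uv(3) by simp
      then have "even (v - u)" by simp
      then obtain c where "v - u = 2 * c" by blast
      then have v: "v = u + 2 * c" by simp
      have "c mod 7 = 1" "(u + c) mod 7 = 2" using uv(1,2) unfolding v by presburger+
      moreover have "c\<^sup>2 + (u + c)\<^sup>2 = int n"
        using uv(3) unfolding v by (simp add: power2_eq_square algebra_simps)
      moreover have "(v - u) div 2 = c" "(u + v) div 2 = u + c" unfolding v by simp_all
      ultimately show "(v - u) div 2 mod 7 = 1 \<and> (u + v) div 2 mod 7 = 2 \<and>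
          ((v - u) div 2)\<^sup>2 + ((u + v) div 2)\<^sup>2 = int n" by simp
    qed
  qed
  from bij_betw_same_card[OF this]
  show "fps_nth (even_part (theta7 1 * theta7 3)) n = fps_nth (theta7 1 * theta7 2 :: 'a fps) n"
    by (simp add: theta7_mult_nth)
qed

section \<open>Three halvings of the reciprocal of x\<close>

text \<open>
  The shift by \<open>q\<close> clears the pole of \<open>1/x\<close>. Applying \<open>U\<^sup>3\<close> to \<open>x\<^sup>8 H q\<^sup>7 = q\<^sup>8 x\<^sup>7\<close> avoids Laurent series.
\<close>

lemma theta7_reciprocal_nth:
  fixes H :: "bit fps"
  assumes "theta7 1 * H = fps_X"
  shows "fps_nth H (8 * m + 1) = fps_nth (theta7 2 * theta7 3) m"
proof -
  let ?x = "theta7 1 :: bit fps" and ?y = "theta7 2 :: bit fps" and ?z = "theta7 3 :: bit fps"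
  let ?E = "even_part :: bit fps \<Rightarrow> bit fps"
  have "?E (?E (?E (?x ^ 7))) = ?x * (?y * ?z)"
  proof -
    \<comment> \<open>The successive images of x^7 are x^3 z^2, x z^3 and x y z; each stage splits
      off a square and leaves x or x z.\<close>
    have "?E (?x ^ 7) = ?E ((?x ^ 3) ^ 2 * ?x)"
      by (rule arg_cong[of _ _ ?E]) (simp add: eval_nat_numeral algebra_simps)
    also have "\<dots> = ?x ^ 3 * ?z ^ 2"
      by (simp only: even_part_square_mult even_part_theta7_1)
    also have "\<dots> = (?x * ?z) ^ 2 * ?x"
      by (simp add: eval_nat_numeral algebra_simps)
    finally have "?E (?E (?x ^ 7)) = ?x * ?z * ?z ^ 2"
      by (simp add: even_part_square_mult even_part_theta7_1)
    then have "?E (?E (?E (?x ^ 7))) = ?E (?x * ?z * ?z ^ 2)"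
      by (rule arg_cong)
    also have "?x * ?z * ?z ^ 2 = ?z ^ 2 * (?x * ?z)"
      by (rule mult.commute)
    also have "?E \<dots> = ?z * (?x * ?y)"
      unfolding even_part_square_mult even_part_theta7_1_mult_3 ..
    also have "\<dots> = ?x * (?y * ?z)"
      by (simp only: mult.commute[of ?z] mult.assoc)
    finally show ?thesis .
  qed
  moreover have "?x * ?E (?E (?E (H * fps_X ^ 7))) = fps_X * ?E (?E (?E (?x ^ 7)))"
  proof -
    have "((?x ^ 2) ^ 2) ^ 2 * (H * fps_X ^ 7) = (?x * H) * ?x ^ 7 * fps_X ^ 7"
      by (simp add: eval_nat_numeral algebra_simps)
    also have "\<dots> = ((fps_X ^ 2) ^ 2) ^ 2 * ?x ^ 7"
      unfolding assms by (simp add: eval_nat_numeral algebra_simps)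
    finally have "?E (?E (?E (((?x ^ 2) ^ 2) ^ 2 * (H * fps_X ^ 7)))) =
        ?E (?E (?E (((fps_X ^ 2) ^ 2) ^ 2 * ?x ^ 7)))"
      by (simp only:)
    then show ?thesis unfolding even_part_square_mult .
  qed
  moreover have "?x \<noteq> 0" using assms by auto
  ultimately have "?E (?E (?E (H * fps_X ^ 7))) = fps_X * (?y * ?z)"
    by (metis mult.left_commute mult_left_cancel)
  \<comment> \<open>Index m + 1 after three halvings is index 8m + 8 of H q^7, hence 8m + 1 of H; on
    the right the factor q shifts back to m.\<close>
  then have "fps_nth (?E (?E (?E (H * fps_X ^ 7)))) (m + 1) = fps_nth (fps_X * (?y * ?z)) (m + 1)"
    by simp
  then show ?thesis
    by (simp add: fps_X_power_mult_right_nth)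
qed

section \<open>From the false theta function to x\<close>

lemma false_theta_9_5_bit_nth:
  "fps_nth (false_theta (- (fps_X ^ 9)) (fps_X ^ 5) :: bit fps) k = fps_nth (theta7 1) (7 * k + 1)"
proof -
  let ?t = "\<lambda>n. fps_nth (false_theta_term (- (fps_X ^ 9)) (fps_X ^ 5) n :: bit fps) k"
  have t: "?t n = of_bool (7 * n\<^sup>2 + 2 * n = int k)" for n
  proof -
    define A B where "A = n * (n + 1) div 2" and "B = n * (n - 1) div 2"
    have "2 * A = n * (n + 1)" "2 * B = n * (n - 1)"
      unfolding A_def B_def by simp_all
    then have "9 * A + 5 * B = 7 * n\<^sup>2 + 2 * n"
      by (simp add: power2_eq_square algebra_simps)
    moreover have "A \<ge> 0" "B \<ge> 0"
      unfolding A_def B_def by (rule triangular_exponents)+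
    ultimately have "k = 9 * nat A + 5 * nat B \<longleftrightarrow> 7 * n\<^sup>2 + 2 * n = int k"
      by linarith
    then show ?thesis
      unfolding false_theta_term_fps_nth A_def[symmetric] B_def[symmetric] by simp
  qed
  let ?S = "\<lambda>A. {n \<in> A. 7 * n\<^sup>2 + 2 * n = int k}"
  have S: "{n. n \<in> A \<and> ?t n \<noteq> 0} = ?S A" for A
    by (auto simp: t)
  have fin: "finite (?S A)" for A
    using finite_false_theta_support[of 9 5 A k, where 'a = bit] unfolding S by simp
  have sum: "sum ?t (?S A) = of_nat (card (?S A))" for A
    by (simp add: t)
  \<comment> \<open>Subtraction in \<open>bit\<close> is addition, so the two halves of the false
    theta function merge into one sum over all integers.\<close>
  have "fps_nth (false_theta (- (fps_X ^ 9)) (fps_X ^ 5) :: bit fps) k =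
      of_nat (card (?S {0..}) + card (?S {..-1}))"
    by (simp only: false_theta_fps_nth[OF zero_less_numeral zero_less_numeral] S sum minus_bit_def of_nat_add)
  also have "card (?S {0..}) + card (?S {..-1}) = card (?S {0..} \<union> ?S {..-1})"
    by (rule card_Un_disjoint[symmetric]) (use fin[of "{0..}"] fin[of "{..-1}"] in auto)
  also have "?S {0..} \<union> ?S {..-1} = {n. 7 * n\<^sup>2 + 2 * n = int k}"
    by auto
  also have "card \<dots> = card {u::int. u mod 7 = 1 \<and> u\<^sup>2 = int (7 * k + 1)}"
  proof (rule bij_betw_same_card[OF bij_betw_byWitness[where f = "\<lambda>n. 7 * n + 1"
        and f' = "\<lambda>u. u div 7"]], goal_cases)
    case 2
    show ?case by (clarsimp, presburger)
  next
    case 3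
    show ?case by (auto simp: power2_eq_square algebra_simps)
  next
    case 4
    show ?case
    proof clarify
      fix u :: int
      assume u: "u mod 7 = 1" "u\<^sup>2 = int (7 * k + 1)"
      have "u = 7 * (u div 7) + 1" using u(1) by presburger
      then obtain n where n: "u = 7 * n + 1" by blast
      then have "u div 7 = n" by simp
      with u(2) show "7 * (u div 7)\<^sup>2 + 2 * (u div 7) = int k"
        unfolding n by (simp add: power2_eq_square algebra_simps)
    qed
  qed auto
  finally show ?thesis by (simp add: theta7_def)
qed

text \<open>The coefficients are defined by an identity over \<open>complex\<close>. All entries are
  integers, so it descends to \<open>int\<close> and can then be reduced modulo 2.\<close>

lemma c_coeff_mult_false_theta:
  fixes r s :: nat
  assumes "r > 0" "s > 0"
  shows "Abs_fps (\<lambda>n. of_int (c_coeff r s n)) *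
     false_theta (- (fps_X ^ r)) (fps_X ^ s) = (1 :: bit fps)"
proof -
  let ?P = "false_theta (- (fps_X ^ r)) (fps_X ^ s) :: complex fps"
  let ?Q = "false_theta (- (fps_X ^ r)) (fps_X ^ s) :: int fps"
  let ?B = "false_theta (- (fps_X ^ r)) (fps_X ^ s) :: bit fps"
  let ?c = "c_coeff r s"
  have P: "Abs_fps (\<lambda>n. of_int (?c n)) * ?P = 1"
    unfolding c_coeff_generating_function[OF assms]
    by (subst fps_divide_unit)
      (simp_all add: false_theta_fps_nth_0[OF assms] inverse_mult_eq_1)
  have B: "fps_nth ?B k = of_int (fps_nth ?Q k)" for k
  proof -
    let ?I = "\<lambda>n. fps_nth (false_theta_term (- (fps_X ^ r)) (fps_X ^ s) n :: int fps) k"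
    let ?J = "\<lambda>n. fps_nth (false_theta_term (- (fps_X ^ r)) (fps_X ^ s) n :: bit fps) k"
    \<comment> \<open>Each coefficient is 0 or a power of -1, so reduction modulo 2 does not shrink
      the index sets of nonzero terms.\<close>
    have "?J n = of_int (?I n)" and "?J n \<noteq> 0 \<longleftrightarrow> ?I n \<noteq> 0" for n
      unfolding false_theta_term_fps_nth by simp_all
    then show ?thesis
      unfolding false_theta_fps_nth[OF assms] by (simp only: of_int_diff of_int_sum)
  qed
  show ?thesis
  proof (rule fps_ext)
    fix n
    have "of_int (\<Sum>i = 0..n. ?c i * fps_nth ?Q (n - i)) =
        fps_nth (Abs_fps (\<lambda>n. of_int (?c n)) * ?P) n"
      by (simp add: fps_mult_nth false_theta_fps_of_int[OF assms])
    also have "\<dots> = of_int (of_bool (n = 0))"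
      by (simp add: P)
    finally have "(\<Sum>i = 0..n. ?c i * fps_nth ?Q (n - i)) = of_bool (n = 0)"
      by (simp only: of_int_eq_iff)
    then have "of_int (\<Sum>i = 0..n. ?c i * fps_nth ?Q (n - i)) = (of_int (of_bool (n = 0)) :: bit)"
      by (simp only:)
    then show "fps_nth (Abs_fps (\<lambda>n. of_int (?c n)) * ?B) n = fps_nth 1 n"
      by (simp only: fps_mult_nth B of_int_sum of_int_mult fps_nth_Abs_fps) simp
  qed
qed

text \<open>The exponents in x are 1 modulo 7, so x is q times the denominator evaluated at q^7.
  Thus q/x carries c(N) at exponent 7N and is the H of \<open>theta7_reciprocal_nth\<close>.\<close>

lemma theta7_1_mult_c_coeff:
  "theta7 1 * (Abs_fps (\<lambda>n. of_int (c_coeff 9 5 n)) oo fps_X ^ 7) = (fps_X :: bit fps)"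
proof -
  let ?C = "Abs_fps (\<lambda>n. of_int (c_coeff 9 5 n)) :: bit fps"
  let ?B = "false_theta (- (fps_X ^ 9)) (fps_X ^ 5) :: bit fps"
  have theta: "theta7 1 = fps_X * (?B oo fps_X ^ 7)"
  proof (rule fps_ext)
    fix n
    show "fps_nth (theta7 1) n = fps_nth (fps_X * (?B oo fps_X ^ 7)) n"
    proof (cases "n mod 7 = 1")
      case True
      then have "n = 7 * (n div 7) + 1" by presburger
      then obtain k where "n = 7 * k + 1" by blast
      then show ?thesis
        by (simp add: fps_nth_compose_X_power false_theta_9_5_bit_nth)
    next
      case False
      have empty: "{u::int. u mod 7 = 1 \<and> u\<^sup>2 = int n} = {}"
      proof safe
        fix u :: int
        assume u: "u mod 7 = 1" "u\<^sup>2 = int n"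
        have "u\<^sup>2 mod 7 = (u mod 7)\<^sup>2 mod 7" by (simp add: power_mod)
        then have "int n mod 7 = 1" using u by simp
        with False show "u \<in> {}" by presburger
      qed
      have "n = 0 \<or> \<not> 7 dvd n - 1" using False by presburger
      then have "fps_nth (fps_X * (?B oo fps_X ^ 7)) n = 0"
        by (auto simp: fps_nth_compose_X_power)
      then show ?thesis
        by (simp only: theta7_def fps_nth_Abs_fps empty card.empty of_nat_0)
    qed
  qed
  have "(?C oo fps_X ^ 7) * (?B oo fps_X ^ 7) = (?C * ?B) oo fps_X ^ 7"
    by (rule fps_compose_mult_distrib[symmetric]) simp
  also have "\<dots> = 1"
    by (simp add: c_coeff_mult_false_theta)
  finally have "fps_X * ((?C oo fps_X ^ 7) * (?B oo fps_X ^ 7)) = fps_X" by simp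
  then show ?thesis unfolding theta by (simp add: algebra_simps)
qed

section \<open>Sums of two squares and the three progressions\<close>

text \<open>Descent on the power of 2: an even sum of two squares is twice another such sum. At the
  bottom, squares are 0 or 1 modulo 4.\<close>

lemma sum_two_squares_neq:
  fixes u v w :: int
  assumes "w mod 4 = 3"
  shows "u\<^sup>2 + v\<^sup>2 \<noteq> 2 ^ j * w"
proof (induction j arbitrary: u v)
  case 0
  have mod4: "a\<^sup>2 mod 4 = 0 \<or> a\<^sup>2 mod 4 = 1" for a :: int
  proof (cases "even a")
    case True
    then obtain b where "a = 2 * b" by blast
    then have "a\<^sup>2 = 4 * b\<^sup>2" by (simp add: power_mult_distrib)
    then show ?thesis by simp
  next
    case False
    then obtain b where "a = 2 * b + 1" by (elim oddE)
    then have "a\<^sup>2 = 1 + 4 * (b\<^sup>2 + b)"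
      by (simp add: power2_eq_square algebra_simps)
    then have "a\<^sup>2 mod 4 = 1 mod 4" by (simp only: mod_mult_self2)
    then show ?thesis by simp
  qed
  have "(u\<^sup>2 + v\<^sup>2) mod 4 = (u\<^sup>2 mod 4 + v\<^sup>2 mod 4) mod 4"
    by (simp only: mod_add_eq)
  then have "(u\<^sup>2 + v\<^sup>2) mod 4 \<noteq> 3"
    using mod4[of u] mod4[of v] by (elim disjE) simp_all
  then show ?case using assms by auto
next
  case (Suc j)
  show ?case
  proof
    assume eq: "u\<^sup>2 + v\<^sup>2 = 2 ^ Suc j * w"
    then have "even (u\<^sup>2 + v\<^sup>2)" by simp
    then have "even (v - u)" by simp
    then obtain c where "v - u = 2 * c" by blast
    then have v: "v = u + 2 * c" by simp
    have "c\<^sup>2 + (u + c)\<^sup>2 = 2 ^ j * w"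
      using eq unfolding v by (simp add: power2_eq_square algebra_simps)
    with Suc.IH show False by blast
  qed
qed

lemma even_c_coeff_9_5:
  fixes j w N :: nat
  assumes "7 * N = 8 * (2 ^ j * w) + 1" and "w mod 4 = 3"
  shows "even (c_coeff 9 5 N)"
proof -
  let ?m = "2 ^ j * w"
  let ?C = "Abs_fps (\<lambda>n. of_int (c_coeff 9 5 n)) :: bit fps"
  have "of_int (c_coeff 9 5 N) = fps_nth (?C oo fps_X ^ 7) (7 * N)"
    by (simp add: fps_nth_compose_X_power)
  also have "\<dots> = fps_nth (theta7 2 * theta7 3) ?m"
    unfolding assms(1) by (rule theta7_reciprocal_nth[OF theta7_1_mult_c_coeff])
  also have "\<dots> = 0"
  proof -
    have "int w mod 4 = 3" using assms(2) by presburger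
    then have "u\<^sup>2 + v\<^sup>2 \<noteq> int ?m" for u v :: int
      using sum_two_squares_neq[of "int w" u v j] by simp
    then have empty: "{(u::int, v::int). u mod 7 = 2 \<and> v mod 7 = 3 \<and> u\<^sup>2 + v\<^sup>2 = int ?m} = {}"
      by blast
    show ?thesis unfolding theta7_mult_nth empty by simp
  qed
  finally show ?thesis unfolding of_int_bit_eq_0_iff .
qed

text \<open>The three congruences are j = 0, 1, 2 with a = 27, 3, 19. As 8 is 1 modulo 7,
  divisibility by 7 need only be checked at k = 0.\<close>

lemma even_c_coeff_9_5_progression:
  fixes j k n a :: nat
  assumes "(a * 2 ^ (j + 3)) mod 7 = 6" and "a mod 4 = 3"
  shows "[c_coeff 9 5 (2 ^ (3 * k + j + 5) * n + (a * 2 ^ (3 * k + j + 3) + 1) div 7) = 0] (mod 2)"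
proof -
  have "(8 ^ k * (a * 2 ^ (j + 3))) mod 7 = (8 ^ k mod 7 * (a * 2 ^ (j + 3) mod 7)) mod 7"
    by (simp only: mod_mult_eq)
  also have "(8::nat) ^ k mod 7 = 1"
    using power_mod[of "8::nat" 7 k] by simp
  also have "8 ^ k * (a * 2 ^ (j + 3)) = a * (2 ^ (3 * k + j + 3) :: nat)"
    by (simp add: power_add power_mult)
  finally have "7 dvd a * 2 ^ (3 * k + j + 3) + 1"
    using assms(1) by (simp only:) presburger
  then have "7 * (2 ^ (3 * k + j + 5) * n + (a * 2 ^ (3 * k + j + 3) + 1) div 7) =
      8 * (2 ^ (3 * k + j) * (28 * n + a)) + 1"
    by (simp add: distrib_left power_add)
  moreover have "(28 * n + a) mod 4 = 3" using assms(2) by presburger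
  ultimately show ?thesis
    using even_c_coeff_9_5 by (simp add: cong_0_iff)
qed

theorem theorem6p1:
  fixes n k :: nat
  shows "[c_coeff 9 5 (2 ^ (3 * k + 5) * n + (27 * 2 ^ (3 * k + 3) + 1) div 7) = 0] (mod 2) \<and>
         [c_coeff 9 5 (2 ^ (3 * k + 6) * n + (3 * 2 ^ (3 * k + 4) + 1) div 7) = 0] (mod 2) \<and>
         [c_coeff 9 5 (2 ^ (3 * k + 7) * n + (19 * 2 ^ (3 * k + 5) + 1) div 7) = 0] (mod 2)"
  using even_c_coeff_9_5_progression[of 27 0 k n] even_c_coeff_9_5_progression[of 3 1 k n]
    even_c_coeff_9_5_progression[of 19 2 k n]
  by (simp add: ac_simps)

end
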